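(* Let $\triangle ABC$ be a (non-degenerate) triangle with V-ellipses $\mathcal{E}_a,\mathcal{E}_b,\mathcal{E}_c$. Then $\mathcal{E}_a,\mathcal{E}_b,\mathcal{E}_c$ are centered at the midpoints of the sides $BC$, $CA$, $AB$, respectively. Their vertices are the external tangency points of the excircles with the sidelines of the triangle (i.e. the two vertices of $\mathcal{E}_a$ are the points where line $BC$ touches the excircles opposite $B$ and opposite $C$, and cyclically for $\mathcal{E}_b,\mathcal{E}_c$), and these six vertices lie on a conic.
   Context: Given a triangle $\triangle ABC$, the V-ellipse $\mathcal{E}_a$ is the ellipse with foci $B,C$ passing through $A$; $\mathcal{E}_b$ is the ellipse with foci $C,A$ passing through $B$; $\mathcal{E}_c$ is the ellipse with foci $A,B$ passing through $C$. The vertices of an ellipse are its two intersections with its focal axis (the line through the foci). The excircle opposite a vertex is the circle tangent to all three sidelines lying across the opposite side from that vertex. Its external tangency points are its contact points with the two sidelines through that vertex, which lie outside the corresponding side segments. *)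

theory Defs
  imports "HOL-Analysis.Analysis"
begin

type_synonym point = "real^2"

abbreviation line_through :: "point \<Rightarrow> point \<Rightarrow> point set" where
  "line_through P Q \<equiv> affine hull {P, Q}"

definition ellipse :: "point \<Rightarrow> point \<Rightarrow> real \<Rightarrow> point set" where
  "ellipse F G l = {X. dist X F + dist X G = l}"

text \<open>The constant distance sum is the one attained at \<open>P\<close>. If \<open>P\<close>, \<open>F\<close>, \<open>G\<close> are not collinear,
  it exceeds \<open>dist F G\<close> by the strict triangle inequality, so this is a genuine ellipse.\<close>

definition V_ellipse :: "point \<Rightarrow> point \<Rightarrow> point \<Rightarrow> point set" where
  "V_ellipse P F G = ellipse F G (dist P F + dist P G)"

definition symmetric_about :: "point set \<Rightarrow> point \<Rightarrow> bool" where
  "symmetric_about S M \<longleftrightarrow> (\<forall>X\<in>S. 2 *\<^sub>R M - X \<in> S)"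

text \<open>The centre of a curve is its one and only centre of point symmetry.\<close>

definition centered_at :: "point set \<Rightarrow> point \<Rightarrow> bool" where
  "centered_at S M \<longleftrightarrow> (\<forall>N. symmetric_about S N \<longleftrightarrow> N = M)"

definition V_vertices :: "point \<Rightarrow> point \<Rightarrow> point \<Rightarrow> point set" where
  "V_vertices P F G = V_ellipse P F G \<inter> line_through F G"

definition is_circle :: "point set \<Rightarrow> bool" where
  "is_circle K \<longleftrightarrow> (\<exists>Z r. r > 0 \<and> K = sphere Z r)"

definition touches_at :: "point set \<Rightarrow> point set \<Rightarrow> point \<Rightarrow> bool" where
  "touches_at K L T \<longleftrightarrow> K \<inter> L = {T}"

definition tangent :: "point set \<Rightarrow> point set \<Rightarrow> bool" where
  "tangent K L \<longleftrightarrow> (\<exists>T. touches_at K L T)"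

text \<open>\<open>P\<close> is the vertex opposite the excircle. The last conjunct says that the circle lies across the
  line \<open>QR\<close> from \<open>P\<close>. It is the weak form of separation, as the contact point with \<open>QR\<close> is on
  that line; the incircle and the other two excircles lie on the same side of \<open>QR\<close> as \<open>P\<close>.\<close>

definition is_excircle :: "point \<Rightarrow> point \<Rightarrow> point \<Rightarrow> point set \<Rightarrow> bool" where
  "is_excircle P Q R K \<longleftrightarrow>
     is_circle K \<and>
     tangent K (line_through P Q) \<and>
     tangent K (line_through Q R) \<and>
     tangent K (line_through R P) \<and>
     (\<forall>X\<in>K. closed_segment P X \<inter> line_through Q R \<noteq> {})"

definition excircle :: "point \<Rightarrow> point \<Rightarrow> point \<Rightarrow> point set" where
  "excircle P Q R = (THE K. is_excircle P Q R K)"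

text \<open>\<open>T\<close> is the contact point of the excircle opposite \<open>P\<close> with the sideline \<open>PQ\<close>.\<close>

definition external_tangency_point :: "point \<Rightarrow> point \<Rightarrow> point \<Rightarrow> point \<Rightarrow> bool" where
  "external_tangency_point P Q R T \<longleftrightarrow>
     touches_at (excircle P Q R) (line_through P Q) T \<and> T \<notin> closed_segment P Q"

text \<open>Degenerate conics (such as line pairs) have to be admitted: for a right triangle the six
  vertices lie on two lines, three on each.\<close>

definition is_conic :: "point set \<Rightarrow> bool" where
  "is_conic S \<longleftrightarrow>
     (\<exists>a b c d e f :: real.
        (a, b, c) \<noteq> (0, 0, 0) \<and>
        S = {X. a * (X$1)\<^sup>2 + b * X$1 * X$2 + c * (X$2)\<^sup>2 + d * X$1 + e * X$2 + f = 0})"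

end

theory Submission
  imports Defs
begin

text \<open>Write \<open>a, b, c\<close> for the side lengths and \<open>s\<close> for the semiperimeter. On the line \<open>BC\<close> the
  condition \<open>XB + XC = b + c\<close> is met exactly by the two points beyond \<open>C\<close> and beyond \<open>B\<close> at
  distance \<open>s\<close> from \<open>B\<close> and from \<open>C\<close>, and the tangent length from a vertex to its excircle
  is also \<open>s\<close>. The barycentric coordinates of the centre of a circle tangent to the three sidelines are
  proportional to \<open>\<plusminus>a, \<plusminus>b, \<plusminus>c\<close>; lying across \<open>BC\<close> fixes the signs, whence the excircle is
  unique. Finally, with \<open>\<alpha> = s / a\<close> the vertices on \<open>BC\<close> have barycentric coordinates
  \<open>(0, 1 - \<alpha>, \<alpha>)\<close> and \<open>(0, \<alpha>, 1 - \<alpha>)\<close>, the zeros of \<open>y\<^sup>2 + z\<^sup>2 - k y z\<close> with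
  \<open>k = 1 / (\<alpha> (1 - \<alpha>)) - 2\<close>. The conic \<open>x\<^sup>2 + y\<^sup>2 + z\<^sup>2 - k\<^sub>a y z - k\<^sub>b x z - k\<^sub>c x y = 0\<close>
  restricts to such a form on every side.\<close>

section \<open>Signed area and lines in the plane\<close>

definition cross2 :: "point \<Rightarrow> point \<Rightarrow> real" where
  "cross2 u v = u$1 * v$2 - u$2 * v$1"

lemma inner_2: "(u::point) \<bullet> v = u$1 * v$1 + u$2 * v$2"
  by (simp add: inner_vec_def sum_2)

text \<open>Lagrange's identity: it bounds \<open>cross2\<close> and makes its vanishing the
  equality case of Cauchy-Schwarz.\<close>

lemma cross2_squared: "(cross2 u v)\<^sup>2 + (u \<bullet> v)\<^sup>2 = (u \<bullet> u) * (v \<bullet> v)"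
  by (simp add: cross2_def inner_2 power2_eq_square algebra_simps)

lemma abs_cross2_le: "\<bar>cross2 u v\<bar> \<le> norm u * norm v"
proof (rule power2_le_imp_le)
  have "(cross2 u v)\<^sup>2 \<le> (u \<bullet> u) * (v \<bullet> v)"
    using cross2_squared[of u v] zero_le_power2[of "u \<bullet> v"] by linarith
  then show "\<bar>cross2 u v\<bar>\<^sup>2 \<le> (norm u * norm v)\<^sup>2"
    by (simp add: power_mult_distrib power2_norm_eq_inner)
qed simp

lemma cross2_eq_0_iff: "cross2 u v = 0 \<longleftrightarrow> collinear {0, u, v}"
proof -
  have "cross2 u v = 0 \<longleftrightarrow> (u \<bullet> v)\<^sup>2 = (norm u * norm v)\<^sup>2"
    using cross2_squared[of u v] by (simp add: power_mult_distrib power2_norm_eq_inner)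
       (metis add_cancel_left_left zero_eq_power2)
  also have "\<dots> \<longleftrightarrow> \<bar>u \<bullet> v\<bar> = norm u * norm v"
    by (metis abs_mult abs_norm_cancel power2_eq_iff_nonneg abs_ge_zero power2_abs)
  finally show ?thesis by (simp add: norm_cauchy_schwarz_equal)
qed

lemma collinear_iff_cross2: "collinear {P, Q, R} \<longleftrightarrow> cross2 (Q - P) (R - P) = 0"
proof -
  have "collinear {P, Q, R} \<longleftrightarrow> collinear {Q, P, R}" by (simp add: insert_commute)
  also have "\<dots> \<longleftrightarrow> cross2 (Q - P) (R - P) = 0"
    by (simp add: collinear_3 cross2_eq_0_iff)
  finally show ?thesis .
qed

lemma mem_line_through: "X \<in> line_through P Q \<longleftrightarrow> (\<exists>t. X = P + t *\<^sub>R (Q - P))"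
proof
  assume "X \<in> line_through P Q"
  then obtain u v where "u + v = 1" "X = u *\<^sub>R P + v *\<^sub>R Q" by (auto simp: affine_hull_2)
  moreover have "u = 1 - v" using \<open>u + v = 1\<close> by simp
  ultimately have "X = P + v *\<^sub>R (Q - P)" by (simp add: algebra_simps)
  then show "\<exists>t. X = P + t *\<^sub>R (Q - P)" by blast
next
  assume "\<exists>t. X = P + t *\<^sub>R (Q - P)"
  then obtain t where "X = (1 - t) *\<^sub>R P + t *\<^sub>R Q" by (auto simp: algebra_simps)
  then show "X \<in> line_through P Q"
    unfolding affine_hull_2 by (intro CollectI exI[of _ "1 - t"] exI[of _ t]) simp
qed

lemma mem_line_through_iff_cross2:
  assumes "P \<noteq> Q"
  shows "X \<in> line_through P Q \<longleftrightarrow> cross2 (Q - P) (X - P) = 0"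
  unfolding collinear_iff_cross2[symmetric] by (rule collinear_3_affine_hull[OF assms, symmetric])

section \<open>Tangency of a circle and a line\<close>

definition foot :: "point \<Rightarrow> point \<Rightarrow> point \<Rightarrow> point" where
  "foot Z P Q = P + (((Z - P) \<bullet> (Q - P)) / ((Q - P) \<bullet> (Q - P))) *\<^sub>R (Q - P)"

text \<open>Pythagoras, split along and across the line and multiplied by
  \<open>d \<bullet> d\<close> to avoid division.\<close>

lemma dist_sq_line:
  assumes "P \<noteq> Q"
  defines "d \<equiv> Q - P"
  shows "(d \<bullet> d) * (dist Z (P + t *\<^sub>R d))\<^sup>2
         = (t * (d \<bullet> d) - (Z - P) \<bullet> d)\<^sup>2 + (cross2 d (Z - P))\<^sup>2"
  unfolding dist_norm power2_norm_eq_inner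
  by (simp add: inner_2 cross2_def power2_eq_square algebra_simps)

lemma sphere_line_inter:
  assumes "P \<noteq> Q" "r > 0"
  defines "d \<equiv> Q - P"
  shows "P + t *\<^sub>R d \<in> sphere Z r \<longleftrightarrow>
         (t * (d \<bullet> d) - (Z - P) \<bullet> d)\<^sup>2 + (cross2 d (Z - P))\<^sup>2 = (r * dist P Q)\<^sup>2"
proof -
  have d: "d \<bullet> d > 0" "(dist P Q)\<^sup>2 = d \<bullet> d"
    using assms by (auto simp: dist_norm power2_norm_eq_inner norm_minus_commute[of P Q])
  have "P + t *\<^sub>R d \<in> sphere Z r \<longleftrightarrow> (dist Z (P + t *\<^sub>R d))\<^sup>2 = r\<^sup>2"
    using assms(2) by (simp add: power2_eq_iff_nonneg)
  also have "\<dots> \<longleftrightarrow> (d \<bullet> d) * (dist Z (P + t *\<^sub>R d))\<^sup>2 = (r * dist P Q)\<^sup>2"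
    using d by (auto simp: power_mult_distrib)
  finally show ?thesis using dist_sq_line[OF assms(1), of Z t, folded d_def] by simp
qed

text \<open>The parameters of the common points solve a quadratic equation that is symmetric about
  the parameter of the foot. A single solution must therefore sit at the foot, and then the distance
  of the line from \<open>Z\<close> equals \<open>r\<close>.\<close>

lemma touches_sphere_line_iff:
  assumes "P \<noteq> Q" "r > 0"
  shows "touches_at (sphere Z r) (line_through P Q) T \<longleftrightarrow>
         \<bar>cross2 (Q - P) (Z - P)\<bar> = r * dist P Q \<and> T = foot Z P Q"
proof -
  define d where "d = Q - P"
  define m where "m = (Z - P) \<bullet> d"
  have d: "d \<bullet> d > 0" "d \<noteq> 0" using assms by (auto simp: d_def)
  note mem = sphere_line_inter[OF assms, of _ Z, folded d_def, folded m_def]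
  have foot: "foot Z P Q = P + (m / (d \<bullet> d)) *\<^sub>R d" by (simp add: foot_def d_def m_def)
  show ?thesis
  proof
    assume "touches_at (sphere Z r) (line_through P Q) T"
    then have T: "sphere Z r \<inter> line_through P Q = {T}" by (simp add: touches_at_def)
    then obtain t where t: "T = P + t *\<^sub>R d" by (auto simp: d_def set_eq_iff mem_line_through)
    then have 1: "(t * (d \<bullet> d) - m)\<^sup>2 + (cross2 d (Z - P))\<^sup>2 = (r * dist P Q)\<^sup>2"
      using T mem by blast
    \<comment> \<open>The mirror image of \<open>t\<close> in the parameter of the foot; uniqueness
      of the contact point will force \<open>t' = t\<close>.\<close>
    define t' where "t' = 2 * m / (d \<bullet> d) - t"
    have "t' * (d \<bullet> d) - m = - (t * (d \<bullet> d) - m)" using d by (simp add: t'_def field_simps)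
    then have "(t' * (d \<bullet> d) - m)\<^sup>2 = (t * (d \<bullet> d) - m)\<^sup>2" by (metis power2_minus)
    then have "P + t' *\<^sub>R d \<in> sphere Z r \<inter> line_through P Q"
      using 1 mem[of t'] by (auto simp: d_def mem_line_through)
    then have "P + t' *\<^sub>R d = P + t *\<^sub>R d" using T t by simp
    then have "t' = t" using d by simp
    then have tm: "t = m / (d \<bullet> d)" by (simp add: t'_def)
    then have "(cross2 d (Z - P))\<^sup>2 = (r * dist P Q)\<^sup>2" using 1 d by simp
    then have "\<bar>cross2 d (Z - P)\<bar> = r * dist P Q"
      using assms(2) by (metis abs_mult abs_of_pos abs_of_nonneg zero_le_dist power2_eq_iff_nonneg abs_ge_zero power2_abs)
    then show "\<bar>cross2 (Q - P) (Z - P)\<bar> = r * dist P Q \<and> T = foot Z P Q"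
      using t tm foot by (simp add: d_def)
  next
    assume asm: "\<bar>cross2 (Q - P) (Z - P)\<bar> = r * dist P Q \<and> T = foot Z P Q"
    then have "(cross2 d (Z - P))\<^sup>2 = (r * dist P Q)\<^sup>2" by (metis d_def power2_abs)
    then have *: "P + t *\<^sub>R d \<in> sphere Z r \<longleftrightarrow> t = m / (d \<bullet> d)" for t
      using mem[of t] d by (auto simp: field_simps)
    have "sphere Z r \<inter> line_through P Q = {foot Z P Q}"
      using * by (auto simp: mem_line_through foot d_def[symmetric] simp del: mem_sphere)
    then show "touches_at (sphere Z r) (line_through P Q) T"
      using asm by (simp add: touches_at_def)
  qed
qed

section \<open>Sides of a line and barycentric coordinates\<close>

text \<open>The ratio is the affine function that is 1 at \<open>P\<close> and 0 on the line; along
  the segment it runs from 1 to its value at \<open>X\<close>, so it attains 0 exactly when that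
  value is not positive.\<close>

lemma segment_meets_line_iff:
  assumes "Q \<noteq> R" and P: "cross2 (R - Q) (P - Q) \<noteq> 0"
  shows "closed_segment P X \<inter> line_through Q R \<noteq> {} \<longleftrightarrow>
         cross2 (R - Q) (X - Q) / cross2 (R - Q) (P - Q) \<le> 0"
proof -
  define D where "D Y = cross2 (R - Q) (Y - Q)" for Y
  have comb: "D ((1 - t) *\<^sub>R P + t *\<^sub>R X) / D P = (1 - t) + t * (D X / D P)" for t
    using P unfolding D_def[symmetric]
    by (simp add: field_simps) (simp add: D_def cross2_def algebra_simps)
  have "closed_segment P X \<inter> line_through Q R \<noteq> {} \<longleftrightarrow>
        (\<exists>t. 0 \<le> t \<and> t \<le> 1 \<and> D ((1 - t) *\<^sub>R P + t *\<^sub>R X) = 0)"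
    unfolding closed_segment_def D_def mem_line_through_iff_cross2[OF assms(1), symmetric] by blast
  also have "\<dots> \<longleftrightarrow> (\<exists>t. 0 \<le> t \<and> t \<le> 1 \<and> (1 - t) + t * (D X / D P) = 0)"
    unfolding comb[symmetric] using P[folded D_def] by simp
  also have "\<dots> \<longleftrightarrow> D X / D P \<le> 0"
  proof
    assume "\<exists>t. 0 \<le> t \<and> t \<le> 1 \<and> (1 - t) + t * (D X / D P) = 0"
    then obtain t where t: "0 \<le> t" "t \<le> 1" "(1 - t) + t * (D X / D P) = 0" by blast
    show "D X / D P \<le> 0"
    proof (rule ccontr)
      assume "\<not> D X / D P \<le> 0"
      then have "t * (D X / D P) > 0 \<or> t = 0" using t(1) by (metis mult_pos_pos not_le order_le_less)
      then show False using t by auto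
    qed
  next
    assume "D X / D P \<le> 0"
    then show "\<exists>t. 0 \<le> t \<and> t \<le> 1 \<and> (1 - t) + t * (D X / D P) = 0"
      \<comment> \<open>The zero of the affine function of \<open>t\<close>; the denominator is at
        least 1, so the witness lies in the unit interval.\<close>
      by (intro exI[of _ "1 / (1 - D X / D P)"]) (simp add: divide_simps, argo?)
  qed
  finally show ?thesis by (simp add: D_def)
qed


text \<open>Cramer's rule: the coordinates are ratios of signed areas.\<close>

lemma barycentric_ex:
  assumes "cross2 (R - Q) (P - Q) \<noteq> 0"
  obtains \<beta> \<gamma> where "Z = P + \<beta> *\<^sub>R (Q - P) + \<gamma> *\<^sub>R (R - P)"
proof
  let ?D = "cross2 (R - Q) (P - Q)"
  have "?D *\<^sub>R (Z - P) = cross2 (P - R) (Z - R) *\<^sub>R (Q - P) + cross2 (Q - P) (Z - P) *\<^sub>R (R - P)"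
    by (simp add: vec_eq_iff forall_2 cross2_def algebra_simps)
  then have "Z - P = (1 / ?D) *\<^sub>R (cross2 (P - R) (Z - R) *\<^sub>R (Q - P) + cross2 (Q - P) (Z - P) *\<^sub>R (R - P))"
    using assms by (metis divide_self_if scaleR_one scaleR_scaleR times_divide_eq_left mult_1)
  then show "Z = P + (cross2 (P - R) (Z - R) / ?D) *\<^sub>R (Q - P) + (cross2 (Q - P) (Z - P) / ?D) *\<^sub>R (R - P)"
    by (simp add: scaleR_add_right algebra_simps)
qed

text \<open>Up to the side lengths these are signed distances of \<open>Z\<close> from the
  sidelines, so tangency to a sideline becomes a condition on one barycentric coordinate.\<close>

lemma barycentric_cross2:
  fixes \<beta> \<gamma> :: real
  assumes "Z = P + \<beta> *\<^sub>R (Q - P) + \<gamma> *\<^sub>R (R - P)"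
  shows "cross2 (Q - P) (Z - P) = \<gamma> * cross2 (R - Q) (P - Q)"
    and "cross2 (P - R) (Z - R) = \<beta> * cross2 (R - Q) (P - Q)"
    and "cross2 (R - Q) (Z - Q) = (1 - \<beta> - \<gamma>) * cross2 (R - Q) (P - Q)"
  unfolding assms by (simp_all add: cross2_def algebra_simps)

section \<open>The excircle: centre, radius and uniqueness\<close>

text \<open>Barycentric coordinates \<open>-p : q : r\<close>, normalised by their sum
  \<open>w\<close>.\<close>

definition excenter :: "point \<Rightarrow> point \<Rightarrow> point \<Rightarrow> point" where
  "excenter P Q R = (let p = dist Q R; q = dist R P; r = dist P Q; w = q + r - p
     in P + (q / w) *\<^sub>R (Q - P) + (r / w) *\<^sub>R (R - P))"

text \<open>The classical quotient of the area by the semiperimeter minus the side opposite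
  \<open>P\<close>, with numerator and denominator doubled.\<close>

definition exradius :: "point \<Rightarrow> point \<Rightarrow> point \<Rightarrow> real" where
  "exradius P Q R = \<bar>cross2 (R - Q) (P - Q)\<bar> / (dist R P + dist P Q - dist Q R)"

lemma noncollinear_triangle:
  assumes "\<not> collinear {P, Q, R}"
  shows "P \<noteq> Q" "Q \<noteq> R" "R \<noteq> P" "cross2 (R - Q) (P - Q) \<noteq> 0"
    "dist Q R < dist R P + dist P Q"
proof -
  show ne: "P \<noteq> Q" "Q \<noteq> R" "R \<noteq> P" using assms by (auto simp: insert_commute)
  show "cross2 (R - Q) (P - Q) \<noteq> 0"
    using assms unfolding collinear_iff_cross2 by (simp add: cross2_def algebra_simps)
  have "dist Q R \<noteq> dist Q P + dist P R"
    using assms between[of Q R P] between_imp_collinear[of Q R P] by (auto simp: insert_commute)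
  then show "dist Q R < dist R P + dist P Q"
    using dist_triangle[of Q R P] by (simp add: dist_commute)
qed

text \<open>A circle tangent to a line lies in one closed half-plane of it, the one that contains
  its centre. Hence the sign of the coordinate of \<open>Z\<close> at \<open>P\<close>
  decides.\<close>

lemma across_iff:
  assumes "\<not> collinear {P, Q, R}" "r > 0"
    and Z: "Z = P + \<beta> *\<^sub>R (Q - P) + \<gamma> *\<^sub>R (R - P)"
    and tangent: "\<bar>1 - \<beta> - \<gamma>\<bar> * \<bar>cross2 (R - Q) (P - Q)\<bar> = r * dist Q R"
  shows "(\<forall>X\<in>sphere Z r. closed_segment P X \<inter> line_through Q R \<noteq> {}) \<longleftrightarrow> 1 - \<beta> - \<gamma> \<le> 0"
proof -
  note tri = noncollinear_triangle[OF assms(1)]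
  define D where "D = cross2 (R - Q) (P - Q)"
  note seg = segment_meets_line_iff[OF tri(2,4), folded D_def]
  have cZ: "cross2 (R - Q) (Z - Q) = (1 - \<beta> - \<gamma>) * D"
    unfolding D_def by (rule barycentric_cross2(3)[OF Z])
  have D: "D \<noteq> 0" using tri by (simp add: D_def)
  show ?thesis
  proof
    assume all: "\<forall>X\<in>sphere Z r. closed_segment P X \<inter> line_through Q R \<noteq> {}"
    \<comment> \<open>Two antipodal points of the circle: their coordinates average to that of the
      centre.\<close>
    define e :: point where "e = r *\<^sub>R axis 1 1"
    have "Z + e \<in> sphere Z r" "Z - e \<in> sphere Z r"
      using assms(2) by (simp_all add: dist_norm e_def norm_axis_1)
    then have "cross2 (R - Q) (Z + e - Q) / D + cross2 (R - Q) (Z - e - Q) / D \<le> 0"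
      using all seg by (meson add_nonpos_nonpos)
    also have "cross2 (R - Q) (Z + e - Q) / D + cross2 (R - Q) (Z - e - Q) / D
        = 2 * (cross2 (R - Q) (Z - Q) / D)"
      unfolding add_divide_distrib[symmetric] by (simp add: cross2_def algebra_simps)
    finally show "1 - \<beta> - \<gamma> \<le> 0" using cZ D by simp
  next
    assume neg: "1 - \<beta> - \<gamma> \<le> 0"
    show "\<forall>X\<in>sphere Z r. closed_segment P X \<inter> line_through Q R \<noteq> {}"
      unfolding seg
    proof
      fix X assume X: "X \<in> sphere Z r"
      have "cross2 (R - Q) (X - Q) / D = (cross2 (R - Q) (Z - Q) + cross2 (R - Q) (X - Z)) / D"
        by (simp add: cross2_def algebra_simps)
      also have "\<dots> = (1 - \<beta> - \<gamma>) + cross2 (R - Q) (X - Z) / D"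
        using cZ D by (simp add: add_divide_distrib)
      \<comment> \<open>Passing from the centre to a point of the circle changes the coordinate by
        at most the radius times \<open>dist Q R / \<bar>D\<bar>\<close>, which by tangency is the
        absolute value of the coordinate of the centre.\<close>
      also have "cross2 (R - Q) (X - Z) / D \<le> \<bar>cross2 (R - Q) (X - Z)\<bar> / \<bar>D\<bar>"
        by (metis abs_ge_self abs_divide)
      also have "\<dots> \<le> dist Q R * r / \<bar>D\<bar>"
        using abs_cross2_le[of "R - Q" "X - Z"] X
        by (intro divide_right_mono) (auto simp: dist_norm norm_minus_commute)
      also have "\<dots> = - (1 - \<beta> - \<gamma>)"
        using tangent neg D by (simp add: D_def[symmetric] field_simps)
      finally show "cross2 (R - Q) (X - Q) / D \<le> 0" by simp
    qed
  qed
qed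

text \<open>The three tangencies fix the absolute values of the barycentric coordinates as a common
  multiple \<open>k\<close> of the sides, and the position across the side makes the coordinate at
  \<open>P\<close> negative. That the coordinates sum to 1 then determines the other signs and
  \<open>k\<close>.\<close>

lemma is_excircle_sphere_iff:
  assumes "\<not> collinear {P, Q, R}" "\<rho> > 0"
  shows "is_excircle P Q R (sphere Z \<rho>) \<longleftrightarrow> Z = excenter P Q R \<and> \<rho> = exradius P Q R"
proof -
  note tri = noncollinear_triangle[OF assms(1)]
  define p q r where "p = dist Q R" "q = dist R P" "r = dist P Q"
  define D where "D = cross2 (R - Q) (P - Q)"
  define w where "w = q + r - p"
  have pos: "p > 0" "q > 0" "r > 0" "w > 0" "q < r + p" "r < p + q"
    using tri noncollinear_triangle(5)[of Q R P] noncollinear_triangle(5)[of R P Q] assms(1)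
    by (auto simp: p_q_r_def w_def insert_commute)
  have D: "D \<noteq> 0" using tri by (simp add: D_def)
  obtain \<beta> \<gamma> where Z: "Z = P + \<beta> *\<^sub>R (Q - P) + \<gamma> *\<^sub>R (R - P)"
    using barycentric_ex[OF tri(4)] .
  note cr = barycentric_cross2[OF Z, folded D_def]
  have "is_excircle P Q R (sphere Z \<rho>) \<longleftrightarrow>
      \<bar>\<gamma>\<bar> * \<bar>D\<bar> = \<rho> * r \<and> \<bar>1 - \<beta> - \<gamma>\<bar> * \<bar>D\<bar> = \<rho> * p \<and> \<bar>\<beta>\<bar> * \<bar>D\<bar> = \<rho> * q \<and> 1 - \<beta> - \<gamma> \<le> 0"
    unfolding is_excircle_def tangent_def touches_sphere_line_iff[OF tri(1) assms(2)]
      touches_sphere_line_iff[OF tri(2) assms(2)] touches_sphere_line_iff[OF tri(3) assms(2)] cr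
    using across_iff[OF assms Z] assms(2)
    by (auto simp: is_circle_def abs_mult p_q_r_def D_def)
  also have "\<dots> \<longleftrightarrow> \<beta> = q / w \<and> \<gamma> = r / w \<and> \<rho> = \<bar>D\<bar> / w"
  proof
    assume asm: "\<bar>\<gamma>\<bar> * \<bar>D\<bar> = \<rho> * r \<and> \<bar>1 - \<beta> - \<gamma>\<bar> * \<bar>D\<bar> = \<rho> * p \<and> \<bar>\<beta>\<bar> * \<bar>D\<bar> = \<rho> * q \<and> 1 - \<beta> - \<gamma> \<le> 0"
    define k where "k = \<rho> / \<bar>D\<bar>"
    have k: "k > 0" using assms(2) D by (simp add: k_def)
    have abs: "\<bar>\<gamma>\<bar> = k * r" "1 - \<beta> - \<gamma> = - (k * p)" "\<bar>\<beta>\<bar> = k * q"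
      using asm D by (auto simp: k_def field_simps)
    \<comment> \<open>Here \<open>\<beta> + \<gamma> = 1 + k * p\<close>. A negative
      \<open>\<beta>\<close> or \<open>\<gamma>\<close> would make the other coordinate too large,
      by the triangle inequalities.\<close>
    have "k * q < k * (r + p)" "k * r < k * (p + q)" "k * p > 0" "k * r > 0" "k * q > 0"
      using k pos by auto
    then have bc: "\<beta> = k * q" "\<gamma> = k * r" using abs by (auto simp: algebra_simps)
    then have "k * w = 1" using abs by (simp add: w_def algebra_simps)
    then have "k = 1 / w" using pos by (simp add: field_simps)
    then show "\<beta> = q / w \<and> \<gamma> = r / w \<and> \<rho> = \<bar>D\<bar> / w"
      using bc D by (auto simp: k_def field_simps)
  next
    assume asm: "\<beta> = q / w \<and> \<gamma> = r / w \<and> \<rho> = \<bar>D\<bar> / w"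
    then have "1 - \<beta> - \<gamma> = - (p / w)" using pos by (simp add: w_def field_simps)
    then show "\<bar>\<gamma>\<bar> * \<bar>D\<bar> = \<rho> * r \<and> \<bar>1 - \<beta> - \<gamma>\<bar> * \<bar>D\<bar> = \<rho> * p \<and> \<bar>\<beta>\<bar> * \<bar>D\<bar> = \<rho> * q \<and> 1 - \<beta> - \<gamma> \<le> 0"
      using asm pos by simp
  qed
  also have "\<dots> \<longleftrightarrow> Z = excenter P Q R \<and> \<rho> = exradius P Q R"
  proof -
    have exr: "exradius P Q R = \<bar>D\<bar> / w" by (simp add: exradius_def D_def w_def p_q_r_def)
    have exc: "excenter P Q R = P + (q / w) *\<^sub>R (Q - P) + (r / w) *\<^sub>R (R - P)"
      by (simp add: excenter_def w_def p_q_r_def Let_def)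
    have "\<beta> = q / w \<and> \<gamma> = r / w" if "Z = excenter P Q R"
      using barycentric_cross2(1,2)[OF that[unfolded exc], folded D_def] cr(1,2) D
      by (metis mult_right_cancel)
    then show ?thesis using exr exc Z by auto
  qed
  finally show ?thesis .
qed

lemma exradius_pos: "\<not> collinear {P, Q, R} \<Longrightarrow> exradius P Q R > 0"
  using noncollinear_triangle[of P Q R] by (simp add: exradius_def)

text \<open>Existence and uniqueness for the \<open>THE\<close> in \<open>excircle\<close>, both
  read off from the equivalence for spheres.\<close>

lemma excircle_eq:
  assumes "\<not> collinear {P, Q, R}"
  shows "excircle P Q R = sphere (excenter P Q R) (exradius P Q R)"
  unfolding excircle_def
proof (rule the_equality)
  show "is_excircle P Q R (sphere (excenter P Q R) (exradius P Q R))"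
    using is_excircle_sphere_iff exradius_pos assms by blast
  fix K assume K: "is_excircle P Q R K"
  then obtain Z r where "r > 0" "K = sphere Z r" by (auto simp: is_excircle_def is_circle_def)
  then show "K = sphere (excenter P Q R) (exradius P Q R)"
    using is_excircle_sphere_iff[OF assms, of r Z] K by simp
qed

section \<open>Contact points and vertices on the sidelines\<close>

definition point_on_ray :: "point \<Rightarrow> point \<Rightarrow> real \<Rightarrow> point" where
  "point_on_ray P Q s = P + (s / dist P Q) *\<^sub>R (Q - P)"

definition semiperimeter :: "point \<Rightarrow> point \<Rightarrow> point \<Rightarrow> real" where
  "semiperimeter P Q R = (dist P Q + dist Q R + dist R P) / 2"

lemma foot_excenter:
  assumes "\<not> collinear {P, Q, R}"
  shows "foot (excenter P Q R) P Q = point_on_ray P Q (semiperimeter P Q R)"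
proof -
  note tri = noncollinear_triangle[OF assms]
  define p q r where "p = dist Q R" "q = dist R P" "r = dist P Q"
  define w where "w = q + r - p"
  have pos: "w > 0" "r > 0" using tri by (auto simp: w_def p_q_r_def)
  have r2: "(Q - P) \<bullet> (Q - P) = r\<^sup>2"
    by (simp add: p_q_r_def dist_norm power2_norm_eq_inner norm_minus_commute[of P])
  \<comment> \<open>Law of cosines at \<open>P\<close>.\<close>
  have cos: "2 * ((R - P) \<bullet> (Q - P)) = q\<^sup>2 + r\<^sup>2 - p\<^sup>2"
    by (simp add: p_q_r_def dist_norm power2_norm_eq_inner inner_2 algebra_simps)
  have "(excenter P Q R - P) \<bullet> (Q - P) =
      (q / w) * ((Q - P) \<bullet> (Q - P)) + (r / w) * ((R - P) \<bullet> (Q - P))"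
    unfolding excenter_def Let_def p_q_r_def[symmetric] w_def[symmetric]
    by (simp only: add.assoc add_diff_cancel_left' inner_add_left inner_scaleR_left)
  then have "w * (2 * ((excenter P Q R - P) \<bullet> (Q - P))) =
      2 * q * ((Q - P) \<bullet> (Q - P)) + r * (2 * ((R - P) \<bullet> (Q - P)))"
    using pos by (simp add: field_simps)
  \<comment> \<open>The right side is \<open>r\<close> times the difference of squares of
    \<open>q + r\<close> and \<open>p\<close>, which contains the factor \<open>w\<close>.\<close>
  also have "\<dots> = w * (r * (p + q + r))"
    unfolding r2 cos w_def by (simp add: power2_eq_square algebra_simps)
  finally have "(excenter P Q R - P) \<bullet> (Q - P) = r * (p + q + r) / 2" using pos by simp
  then have "(excenter P Q R - P) \<bullet> (Q - P) / r\<^sup>2 = (r + p + q) / 2 / r"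
    using pos by (simp add: power2_eq_square field_simps)
  then show ?thesis
    unfolding foot_def point_on_ray_def semiperimeter_def r2 p_q_r_def[symmetric] by simp
qed

text \<open>The contact point is the foot of the excenter. Its distance from \<open>P\<close> is the
  semiperimeter, which exceeds \<open>dist P Q\<close>, so it falls beyond \<open>Q\<close>.\<close>

lemma external_tangency_point_iff:
  assumes "\<not> collinear {P, Q, R}"
  shows "external_tangency_point P Q R T \<longleftrightarrow> T = point_on_ray P Q (semiperimeter P Q R)"
proof -
  note tri = noncollinear_triangle[OF assms]
  let ?T = "point_on_ray P Q (semiperimeter P Q R)"
  have "tangent (excircle P Q R) (line_through P Q)"
    using is_excircle_sphere_iff[OF assms exradius_pos[OF assms]] excircle_eq[OF assms]
    by (auto simp: is_excircle_def)
  then have "touches_at (excircle P Q R) (line_through P Q) T \<longleftrightarrow> T = ?T"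
    unfolding tangent_def excircle_eq[OF assms] foot_excenter[OF assms]
      touches_sphere_line_iff[OF tri(1) exradius_pos[OF assms]] by blast
  moreover have "?T \<notin> closed_segment P Q"
  proof
    assume "?T \<in> closed_segment P Q"
    then have "dist ?T P \<le> dist P Q" using dist_in_closed_segment by blast
    moreover have "dist ?T P = semiperimeter P Q R"
      using tri by (simp add: point_on_ray_def dist_norm semiperimeter_def norm_minus_commute)
    moreover have "dist P Q < dist Q R + dist R P"
      using noncollinear_triangle(5)[of R P Q] assms by (simp add: insert_commute)
    ultimately show False by (simp add: semiperimeter_def)
  qed
  ultimately show ?thesis unfolding external_tangency_point_def by blast
qed

lemma V_vertices_eq:
  assumes "\<not> collinear {P, F, G}"
  shows "V_vertices P F G =
    {point_on_ray F G (semiperimeter P F G), point_on_ray G F (semiperimeter P F G)}"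
proof -
  define a where "a = dist F G"
  define l where "l = dist P F + dist P G"
  have a: "a > 0" "a < l" using noncollinear_triangle[OF assms] by (auto simp: a_def l_def dist_commute)
  have s: "semiperimeter P F G = (a + l) / 2"
    by (simp add: semiperimeter_def a_def l_def dist_commute)
  have on: "F + t *\<^sub>R (G - F) \<in> V_ellipse P F G \<longleftrightarrow> t = (a + l) / (2 * a) \<or> t = 1 - (a + l) / (2 * a)"
    for t
  proof -
    have "F + t *\<^sub>R (G - F) - G = (t - 1) *\<^sub>R (G - F)" by (simp add: algebra_simps)
    then have "F + t *\<^sub>R (G - F) \<in> V_ellipse P F G \<longleftrightarrow> \<bar>t\<bar> * a + \<bar>t - 1\<bar> * a = l"
      by (simp add: V_ellipse_def ellipse_def l_def dist_norm a_def norm_minus_commute)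
    also have "\<dots> \<longleftrightarrow> \<bar>t\<bar> + \<bar>t - 1\<bar> = l / a" using a by (simp add: field_simps)
    also have "\<dots> \<longleftrightarrow> t = (1 + l / a) / 2 \<or> t = 1 - (1 + l / a) / 2"
    proof -
      \<comment> \<open>Between the foci the sum is 1, which is less than \<open>y\<close>; outside
        it is linear in \<open>t\<close> with one solution on either side.\<close>
      have "\<bar>t\<bar> + \<bar>t - 1\<bar> = y \<longleftrightarrow> 2 * t = 1 + y \<or> 2 * t = 1 - y" if "1 < y" for y
        using that by (auto simp: abs_if)
      from this[of "l / a"] show ?thesis using a by (auto simp: field_simps)
    qed
    also have "(1 + l / a) / 2 = (a + l) / (2 * a)" using a by (simp add: field_simps)
    finally show ?thesis .
  qed
  \<comment> \<open>Both vertices are parametrised from \<open>F\<close>, so the ray from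
    \<open>G\<close> receives the complementary parameter.\<close>
  have GF: "point_on_ray G F ((a + l) / 2) = F + (1 - (a + l) / (2 * a)) *\<^sub>R (G - F)"
    by (simp add: point_on_ray_def a_def dist_commute algebra_simps)
  have FG: "point_on_ray F G ((a + l) / 2) = F + ((a + l) / (2 * a)) *\<^sub>R (G - F)"
    by (simp add: point_on_ray_def a_def)
  show ?thesis
    unfolding s GF FG V_vertices_def using on by (auto simp: set_eq_iff mem_line_through)
qed

section \<open>The centre of a V-ellipse\<close>

lemma V_ellipse_centered: "centered_at (V_ellipse P F G) (midpoint F G)"
  unfolding centered_at_def
proof
  fix N
  let ?S = "V_ellipse P F G" and ?M = "midpoint F G"
  have refl: "2 *\<^sub>R ?M - X = F + G - X" for X by (simp add: midpoint_def)
  have sym: "symmetric_about ?S ?M"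
    unfolding symmetric_about_def V_ellipse_def ellipse_def refl
    by (simp add: dist_norm norm_minus_commute add.commute)
  show "symmetric_about ?S N \<longleftrightarrow> N = ?M"
  proof
    assume N: "symmetric_about ?S N"
    define v where "v = 2 *\<^sub>R (N - ?M)"
    \<comment> \<open>Two point symmetries compose to a translation, which a bounded set does not admit.\<close>
    have step: "X + v \<in> ?S" if "X \<in> ?S" for X
    proof -
      have "2 *\<^sub>R N - (2 *\<^sub>R ?M - X) \<in> ?S" using N sym that unfolding symmetric_about_def by blast
      then show ?thesis by (simp add: v_def algebra_simps)
    qed
    have iter: "P + real n *\<^sub>R v \<in> ?S" for n
    proof (induction n)
      case 0
      then show ?case by (simp add: V_ellipse_def ellipse_def)
    next
      case (Suc n)
      then show ?case using step[OF Suc] by (simp add: algebra_simps)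
    qed
    \<comment> \<open>Points of the ellipse are within \<open>l\<close> of \<open>F\<close>, hence
      within \<open>2 * l\<close> of \<open>P\<close>, whatever \<open>n\<close> is; this leaves
      only \<open>v = 0\<close>.\<close>
    define l where "l = dist P F + dist P G"
    have "real n * norm v \<le> 2 * l" for n
    proof -
      have "dist (P + real n *\<^sub>R v) F \<le> l"
        using iter[of n] zero_le_dist[of "P + real n *\<^sub>R v" G]
        by (simp add: V_ellipse_def ellipse_def l_def del: zero_le_dist)
      moreover have "dist (P + real n *\<^sub>R v) P \<le> dist (P + real n *\<^sub>R v) F + dist P F"
        by (metis dist_triangle2)
      moreover have "dist P F \<le> l" by (simp add: l_def)
      ultimately show ?thesis by (simp add: dist_norm)
    qed
    then have "\<not> 0 < norm v" by (meson reals_Archimedean3 not_le)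
    then show "N = ?M" by (simp add: v_def)
  qed (use sym in simp)
qed

section \<open>A conic through six points\<close>

text \<open>Substituting affine functions keeps the degree at most 2. Along the direction
  \<open>(w1, w2)\<close> the function \<open>l\<close> has slope 1 and \<open>m\<close> slope 0, so
  the quadratic part takes the value \<open>a\<close> there and cannot vanish identically.\<close>

lemma is_conic_affine_quadratic:
  fixes l m :: "point \<Rightarrow> real"
  assumes l: "\<And>X. l X = l0 + l1 * X$1 + l2 * X$2"
    and m: "\<And>X. m X = m0 + m1 * X$1 + m2 * X$2"
    and dir: "l1 * w1 + l2 * w2 = 1" "m1 * w1 + m2 * w2 = 0"
    and "a \<noteq> 0"
  shows "is_conic {X. a * (l X)\<^sup>2 + b * l X * m X + c * (m X)\<^sup>2 + d * l X + e * m X + f = 0}"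
proof -
  define a' where "a' = a * l1\<^sup>2 + b * l1 * m1 + c * m1\<^sup>2"
  define b' where "b' = 2 * a * l1 * l2 + b * (l1 * m2 + l2 * m1) + 2 * c * m1 * m2"
  define c' where "c' = a * l2\<^sup>2 + b * l2 * m2 + c * m2\<^sup>2"
  define d' where "d' = 2 * a * l0 * l1 + b * (l0 * m1 + l1 * m0) + 2 * c * m0 * m1 + d * l1 + e * m1"
  define e' where "e' = 2 * a * l0 * l2 + b * (l0 * m2 + l2 * m0) + 2 * c * m0 * m2 + d * l2 + e * m2"
  define f' where "f' = a * l0\<^sup>2 + b * l0 * m0 + c * m0\<^sup>2 + d * l0 + e * m0 + f"
  have "a' * w1\<^sup>2 + b' * w1 * w2 + c' * w2\<^sup>2 = a * (l1 * w1 + l2 * w2)\<^sup>2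
      + b * (l1 * w1 + l2 * w2) * (m1 * w1 + m2 * w2) + c * (m1 * w1 + m2 * w2)\<^sup>2"
    by (simp add: a'_def b'_def c'_def power2_eq_square algebra_simps)
  then have "(a', b', c') \<noteq> (0, 0, 0)" using dir \<open>a \<noteq> 0\<close> by auto
  moreover have "a * (l X)\<^sup>2 + b * l X * m X + c * (m X)\<^sup>2 + d * l X + e * m X + f
      = a' * (X$1)\<^sup>2 + b' * X$1 * X$2 + c' * (X$2)\<^sup>2 + d' * X$1 + e' * X$2 + f'" for X
    unfolding l m a'_def b'_def c'_def d'_def e'_def f'_def
    by (simp add: power2_eq_square algebra_simps)
  ultimately show ?thesis
    unfolding is_conic_def
    by (intro exI[of _ a'] exI[of _ b'] exI[of _ c'] exI[of _ d'] exI[of _ e'] exI[of _ f']) simp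
qed


lemma affine_coordinates_inject:
  assumes "cross2 u v \<noteq> 0"
  shows "A + y *\<^sub>R u + z *\<^sub>R v = A + y' *\<^sub>R u + z' *\<^sub>R v \<longleftrightarrow> y = y' \<and> z = z'"
proof
  assume "A + y *\<^sub>R u + z *\<^sub>R v = A + y' *\<^sub>R u + z' *\<^sub>R v"
  then have eq: "y *\<^sub>R u + z *\<^sub>R v = y' *\<^sub>R u + z' *\<^sub>R v" by (simp add: add.assoc)
  have cr: "cross2 (y *\<^sub>R u + z *\<^sub>R v) v = y * cross2 u v" "cross2 u (y *\<^sub>R u + z *\<^sub>R v) = z * cross2 u v" for y z
    by (simp_all add: cross2_def algebra_simps)
  from cr[of y z] cr[of y' z'] have "y * cross2 u v = y' * cross2 u v" "z * cross2 u v = z' * cross2 u v"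
    by (simp_all only: eq)
  then show "y = y' \<and> z = z'" using assms by simp
qed simp

lemma conic_through_six_points:
  assumes "cross2 u v \<noteq> 0"
    and ne: "\<alpha> \<notin> {0, 1}" "\<beta> \<notin> {0, 1}" "\<gamma> \<notin> {0, 1 :: real}"
  shows "\<exists>S. is_conic S \<and>
    {A + \<gamma> *\<^sub>R u, A + (1 - \<gamma>) *\<^sub>R u, A + \<beta> *\<^sub>R v, A + (1 - \<beta>) *\<^sub>R v,
     A + (1 - \<alpha>) *\<^sub>R u + \<alpha> *\<^sub>R v, A + \<alpha> *\<^sub>R u + (1 - \<alpha>) *\<^sub>R v} \<subseteq> S"
proof -
  define D where "D = cross2 u v"
  have D: "D \<noteq> 0" using assms by (simp add: D_def)
  define y where "y X = cross2 (X - A) v / D" for X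
  define z where "z X = cross2 u (X - A) / D" for X
  \<comment> \<open>Chosen so that \<open>t\<close> and \<open>1 - t\<close> satisfy the equation on
    their side; \<open>k t = -2\<close> would need a vanishing reciprocal.\<close>
  define k where "k t = 1 / (t * (1 - t)) - 2" for t :: real
  have k: "t\<^sup>2 + (1 - t)\<^sup>2 = k t * t * (1 - t)" "k t \<noteq> -2" if "t \<notin> {0, 1}" for t
    using that by (simp_all add: k_def field_simps power2_eq_square)
  \<comment> \<open>The conic in barycentric coordinates with the first one replaced by
    \<open>1 - s - t\<close>, expanded to expose the coefficients.\<close>
  define q where "q s t = (2 + k \<gamma>) * s\<^sup>2 + (2 - k \<alpha> + k \<beta> + k \<gamma>) * s * t + (2 + k \<beta>) * t\<^sup>2
      + (- 2 - k \<gamma>) * s + (- 2 - k \<beta>) * t + 1" for s t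
  have q: "q s t = (1 - s - t)\<^sup>2 + s\<^sup>2 + t\<^sup>2 - k \<alpha> * s * t - k \<beta> * (1 - s - t) * t - k \<gamma> * (1 - s - t) * s" for s t
    by (simp add: q_def power2_eq_square algebra_simps)
  have "is_conic {X. q (y X) (z X) = 0}"
    unfolding q_def
  proof (rule is_conic_affine_quadratic)
    show "y X = (- cross2 A v / D) + (v$2 / D) * X$1 + (- v$1 / D) * X$2" for X
      using D by (simp add: y_def cross2_def field_simps)
    show "z X = (- cross2 u A / D) + (- u$2 / D) * X$1 + (u$1 / D) * X$2" for X
      using D by (simp add: z_def cross2_def field_simps)
    \<comment> \<open>The direction is \<open>u\<close>, along which \<open>y\<close> has slope 1
      and \<open>z\<close> is constant.\<close>
    show "v$2 / D * u$1 + - v$1 / D * u$2 = 1"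
      using D by (simp add: field_simps) (simp add: D_def cross2_def algebra_simps)
    show "- u$2 / D * u$1 + u$1 / D * u$2 = 0" by simp
    show "2 + k \<gamma> \<noteq> 0" using k(2)[OF ne(3)] by simp
  qed
  moreover have co: "y (A + s *\<^sub>R u + t *\<^sub>R v) = s" "z (A + s *\<^sub>R u + t *\<^sub>R v) = t" for s t
  proof -
    have "cross2 (A + s *\<^sub>R u + t *\<^sub>R v - A) v = s * D" "cross2 u (A + s *\<^sub>R u + t *\<^sub>R v - A) = t * D"
      by (simp_all add: D_def cross2_def algebra_simps)
    then show "y (A + s *\<^sub>R u + t *\<^sub>R v) = s" "z (A + s *\<^sub>R u + t *\<^sub>R v) = t"
      using D by (simp_all only: y_def z_def nonzero_mult_div_cancel_right not_False_eq_True)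
  qed
  have co0: "y (A + s *\<^sub>R u) = s" "z (A + s *\<^sub>R u) = 0" "y (A + s *\<^sub>R v) = 0" "z (A + s *\<^sub>R v) = s" for s
    using co[of s 0] co[of 0 s] by simp_all
  have "q \<gamma> 0 = 0" "q (1 - \<gamma>) 0 = 0" "q 0 \<beta> = 0" "q 0 (1 - \<beta>) = 0" "q (1 - \<alpha>) \<alpha> = 0" "q \<alpha> (1 - \<alpha>) = 0"
    unfolding q using k(1)[OF ne(1)] k(1)[OF ne(2)] k(1)[OF ne(3)] by (simp_all add: mult_ac add_ac)
  then have "{A + \<gamma> *\<^sub>R u, A + (1 - \<gamma>) *\<^sub>R u, A + \<beta> *\<^sub>R v, A + (1 - \<beta>) *\<^sub>R v,
     A + (1 - \<alpha>) *\<^sub>R u + \<alpha> *\<^sub>R v, A + \<alpha> *\<^sub>R u + (1 - \<alpha>) *\<^sub>R v} \<subseteq> {X. q (y X) (z X) = 0}"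
    by (simp add: co co0)
  ultimately show ?thesis by blast
qed

text \<open>Each point has one zero, one negative and one positive barycentric coordinate, and the
  six sign patterns differ.\<close>

lemma card_six_points:
  assumes D: "cross2 u v \<noteq> 0"
    and ne: "\<alpha> > 1" "\<beta> > 1" "\<gamma> > (1 :: real)"
  shows "card {A + \<gamma> *\<^sub>R u, A + (1 - \<gamma>) *\<^sub>R u, A + \<beta> *\<^sub>R v, A + (1 - \<beta>) *\<^sub>R v,
     A + (1 - \<alpha>) *\<^sub>R u + \<alpha> *\<^sub>R v, A + \<alpha> *\<^sub>R u + (1 - \<alpha>) *\<^sub>R v} = 6"
proof -
  let ?L = "[(\<gamma>, 0), (1 - \<gamma>, 0), (0, \<beta>), (0, 1 - \<beta>), (1 - \<alpha>, \<alpha>), (\<alpha>, 1 - \<alpha>)]"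
  have "inj (\<lambda>(s, t). A + s *\<^sub>R u + t *\<^sub>R v)"
    by (auto simp: inj_def affine_coordinates_inject[OF D])
  moreover have "distinct ?L" using ne by auto
  ultimately have "distinct (map (\<lambda>(s, t). A + s *\<^sub>R u + t *\<^sub>R v) ?L)"
    unfolding distinct_map by (meson inj_on_subset subset_UNIV)
  from distinct_card[OF this] show ?thesis by simp
qed

theorem proposition1:
  fixes A B C :: point
  assumes "\<not> collinear {A, B, C}"
  shows "centered_at (V_ellipse A B C) (midpoint B C) \<and>
         centered_at (V_ellipse B C A) (midpoint C A) \<and>
         centered_at (V_ellipse C A B) (midpoint A B) \<and>
         (\<exists>T U. external_tangency_point B C A T \<and> external_tangency_point C B A U \<and>
                V_vertices A B C = {T, U}) \<and>
         (\<exists>T U. external_tangency_point C A B T \<and> external_tangency_point A C B U \<and>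
                V_vertices B C A = {T, U}) \<and>
         (\<exists>T U. external_tangency_point A B C T \<and> external_tangency_point B A C U \<and>
                V_vertices C A B = {T, U}) \<and>
         card (V_vertices A B C \<union> V_vertices B C A \<union> V_vertices C A B) = 6 \<and>
         (\<exists>S. is_conic S \<and> V_vertices A B C \<union> V_vertices B C A \<union> V_vertices C A B \<subseteq> S)"
proof -
  define s where "s = semiperimeter A B C"
  note tri = noncollinear_triangle[OF assms]
  have sp: "semiperimeter B C A = s" "semiperimeter C A B = s" "semiperimeter A C B = s"
      "semiperimeter C B A = s" "semiperimeter B A C = s" "semiperimeter A B C = s"
    by (simp_all add: s_def semiperimeter_def dist_commute)
  have nc: "\<not> collinear {B, C, A}" "\<not> collinear {C, A, B}" "\<not> collinear {A, C, B}"
      "\<not> collinear {C, B, A}" "\<not> collinear {B, A, C}"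
    using assms by (simp_all add: insert_commute)
  note ext = external_tangency_point_iff[OF assms] nc[THEN external_tangency_point_iff]
  note vert = V_vertices_eq[OF assms] V_vertices_eq[OF nc(1)] V_vertices_eq[OF nc(2)]
  define \<alpha> \<beta> \<gamma> where "\<alpha> = s / dist B C" "\<beta> = s / dist C A" "\<gamma> = s / dist A B"
  \<comment> \<open>Each side is shorter than the semiperimeter, by the triangle inequality.\<close>
  have gt: "\<alpha> > 1" "\<beta> > 1" "\<gamma> > 1"
    using tri noncollinear_triangle(5)[OF nc(1)] noncollinear_triangle(5)[OF nc(2)]
    by (auto simp: \<alpha>_\<beta>_\<gamma>_def s_def semiperimeter_def)
  have D: "cross2 (B - A) (C - A) \<noteq> 0" using assms collinear_iff_cross2 by blast
  \<comment> \<open>In the affine frame at \<open>A\<close> with axes \<open>B - A\<close> and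
    \<open>C - A\<close>, the vertices on the line through \<open>B\<close> and \<open>C\<close> are
    those whose coordinates sum to 1.\<close>
  have all: "V_vertices A B C \<union> V_vertices B C A \<union> V_vertices C A B =
    {A + \<gamma> *\<^sub>R (B - A), A + (1 - \<gamma>) *\<^sub>R (B - A), A + \<beta> *\<^sub>R (C - A), A + (1 - \<beta>) *\<^sub>R (C - A),
     A + (1 - \<alpha>) *\<^sub>R (B - A) + \<alpha> *\<^sub>R (C - A), A + \<alpha> *\<^sub>R (B - A) + (1 - \<alpha>) *\<^sub>R (C - A)}"
  proof -
    have "point_on_ray A B s = A + \<gamma> *\<^sub>R (B - A)" "point_on_ray B A s = A + (1 - \<gamma>) *\<^sub>R (B - A)"
      "point_on_ray A C s = A + \<beta> *\<^sub>R (C - A)" "point_on_ray C A s = A + (1 - \<beta>) *\<^sub>R (C - A)"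
      "point_on_ray B C s = A + (1 - \<alpha>) *\<^sub>R (B - A) + \<alpha> *\<^sub>R (C - A)"
      "point_on_ray C B s = A + \<alpha> *\<^sub>R (B - A) + (1 - \<alpha>) *\<^sub>R (C - A)"
      by (simp_all add: point_on_ray_def \<alpha>_\<beta>_\<gamma>_def dist_commute algebra_simps)
    then show ?thesis unfolding vert sp by auto
  qed
  show ?thesis
    unfolding all unfolding ext sp vert
    using V_ellipse_centered card_six_points[OF D gt] conic_through_six_points[OF D, of \<alpha> \<beta> \<gamma> A] gt
    by auto
qed

end
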